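(* Let $T$ be a right Hopf monad on a right autonomous category $\mathcal{C}$. Let $(M,r,\rho)$ be a right Hopf $T$-module such that the right $T$-comodule $(M,\rho)$ admits a coinvariant part $i\colon M^{\mathrm{co}T}\to M$ which is preserved by $T$. Then $$r\,T(i)\colon \bigl(T(M^{\mathrm{co}T}),\,\mu_{M^{\mathrm{co}T}},\,T_2(M^{\mathrm{co}T},\mathbf 1)\bigr)\to (M,r,\rho)$$ is an isomorphism of right Hopf $T$-modules.
   Context: Conventions: categories are small, monoidal categories $(\mathcal{C},\otimes,\mathbf 1)$ are strict; composition of $f$ followed by $g$ is written $gf$; "functorial" means natural. Monads: a monad on $\mathcal{C}$ is $(T,\mu\colon T^2\to T,\eta\colon 1_{\mathcal C}\to T)$ with $\mu_XT(\mu_X)=\mu_X\mu_{T(X)}$, $\mu_X\eta_{T(X)}=\mathrm{id}=\mu_XT(\eta_X)$. A $T$-module is $(M,r)$ with $r\colon T(M)\to M$, $rT(r)=r\mu_M$, $r\eta_M=\mathrm{id}_M$; a $T$-linear morphism $f\colon(M,r)\to(N,s)$ satisfies $fr=sT(f)$. Bimonads: a bimonad on a monoidal category $\mathcal{C}$ is a monad $T$ equipped with natural $T_2(X,Y)\colon T(X\otimes Y)\to T(X)\otimes T(Y)$ and $T_0\colon T(\mathbf 1)\to\mathbf 1$ with $(\mathrm{id}\otimes T_2(Y,Z))T_2(X,Y\otimes Z)=(T_2(X,Y)\otimes \mathrm{id})T_2(X\otimes Y,Z)$, $(\mathrm{id}\otimes T_0)T_2(X,\mathbf 1)=\mathrm{id}=(T_0\otimes\mathrm{id})T_2(\mathbf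 1,X)$, $T_2(X,Y)\mu_{X\otimes Y}=(\mu_X\otimes\mu_Y)T_2(T(X),T(Y))T(T_2(X,Y))$, $T_0\mu_{\mathbf 1}=T_0T(T_0)$, $T_2(X,Y)\eta_{X\otimes Y}=\eta_X\otimes\eta_Y$, $T_0\eta_{\mathbf 1}=\mathrm{id}_{\mathbf 1}$. Right Hopf monads: $\mathcal{C}$ is right autonomous if each object $X$ has a (chosen) right dual $(X^\vee,\widetilde{\mathrm{ev}}_X\colon X\otimes X^\vee\to\mathbf 1,\widetilde{\mathrm{coev}}_X\colon\mathbf 1\to X^\vee\otimes X)$. A right Hopf monad is a bimonad $T$ on a right autonomous category admitting a right antipode, i.e. a functorial family $s^r_X\colon T(T(X)^\vee)\to X^\vee$ such that for all $X$: $T_0T(\widetilde{\mathrm{ev}}_X)T(\mathrm{id}_X\otimes\eta_X^\vee)=\widetilde{\mathrm{ev}}_{T(X)}(\mathrm{id}_{T(X)}\otimes s^r_{T(X)}T(\mu_X^\vee))T_2(X,T(X)^\vee)$ and $(\mathrm{id}_{X^\vee}\otimes\eta_X)\widetilde{\mathrm{coev}}_XT_0=(s^r_X\otimes\mu_X)T_2(T(X)^\vee,T(X))T(\widetilde{\mathrm{coev}}_{T(X)})$. Hopf modules: $T(\mathbf 1)$ is a coalgebra in $\mathcal{C}$ with coproduct $T_2(\mathbf 1,\mathbf 1)$ and counit $T_0$; a right $T$-comodule is a right $T(\mathbf 1)$-comodule $(M,\rho\colon M\to M\otimes T(\mathbf 1))$. A right Hopf $T$-module is a triple $(M,r,\rho)$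 with $(M,r)$ a $T$-module, $(M,\rho)$ a right $T$-comodule and $\rho r=(r\otimes\mu_{\mathbf 1})T_2(M,T(\mathbf 1))T(\rho)$. A morphism of right Hopf $T$-modules is a $T$-linear morphism that is also a morphism of right $T$-comodules. For every object $X$, $(T(X),\mu_X,T_2(X,\mathbf 1))$ is a right Hopf $T$-module. Coinvariants: the coinvariant part of a right $T$-comodule $(M,\rho)$ is, if it exists, an equalizer $i\colon M^{\mathrm{co}T}\to M$ of the pair $\rho,\ \mathrm{id}_M\otimes\eta_{\mathbf 1}\colon M\to M\otimes T(\mathbf 1)$. It is preserved by $T$ if $T(i)$ is an equalizer of $T(\rho),\ T(\mathrm{id}_M\otimes\eta_{\mathbf 1})$. *)

theory Defs
  imports Main
begin

section \<open>Categories\<close>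

text \<open>
  A small category has a set of objects in a type \<open>'o\<close> and a set of arrows in a type \<open>'a\<close>,
  each arrow having a unique domain and codomain. The operations are total functions, and their
  values outside the intended domain are irrelevant. Composition is in applicative order:
  \<open>g \<cdot> f\<close> is \<open>f\<close> followed by \<open>g\<close>.
\<close>

record ('o, 'a) category =
  Obj :: "'o set"
  Arr :: "'a set"
  Dom :: "'a \<Rightarrow> 'o"
  Cod :: "'a \<Rightarrow> 'o"
  ident :: "'o \<Rightarrow> 'a"  ("\<i>\<d>\<index>")
  comp_arr :: "'a \<Rightarrow> 'a \<Rightarrow> 'a"  (infixr "\<cdot>\<index>" 65)

definition hom :: "('o, 'a, 'm) category_scheme \<Rightarrow> 'o \<Rightarrow> 'o \<Rightarrow> 'a set" where
  "hom C X Y = {f \<in> Arr C. Dom C f = X \<and> Cod C f = Y}"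

locale category =
  fixes C :: "('o, 'a, 'm) category_scheme" (structure)
  assumes dom_closed: "f \<in> Arr C \<Longrightarrow> Dom C f \<in> Obj C"
    and cod_closed: "f \<in> Arr C \<Longrightarrow> Cod C f \<in> Obj C"
    and ident_closed: "X \<in> Obj C \<Longrightarrow> \<i>\<d> X \<in> hom C X X"
    and comp_closed: "\<lbrakk>f \<in> hom C X Y; g \<in> hom C Y Z\<rbrakk> \<Longrightarrow> g \<cdot> f \<in> hom C X Z"
    and comp_ident_right: "f \<in> hom C X Y \<Longrightarrow> f \<cdot> \<i>\<d> X = f"
    and comp_ident_left: "f \<in> hom C X Y \<Longrightarrow> \<i>\<d> Y \<cdot> f = f"
    and comp_assoc: "\<lbrakk>f \<in> hom C W X; g \<in> hom C X Y; h \<in> hom C Y Z\<rbrakk>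
      \<Longrightarrow> (h \<cdot> g) \<cdot> f = h \<cdot> (g \<cdot> f)"

definition is_equalizer :: "('o, 'a, 'm) category_scheme \<Rightarrow> 'a \<Rightarrow> 'a \<Rightarrow> 'a \<Rightarrow> bool" where
  "is_equalizer C i f g \<longleftrightarrow>
     (\<exists>E A B. i \<in> hom C E A \<and> f \<in> hom C A B \<and> g \<in> hom C A B \<and>
        f \<cdot>\<^bsub>C\<^esub> i = g \<cdot>\<^bsub>C\<^esub> i \<and>
        (\<forall>Z h. h \<in> hom C Z A \<and> f \<cdot>\<^bsub>C\<^esub> h = g \<cdot>\<^bsub>C\<^esub> h \<longrightarrow>
           (\<exists>!k. k \<in> hom C Z E \<and> i \<cdot>\<^bsub>C\<^esub> k = h)))"


section \<open>Strict monoidal and right autonomous categories\<close>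

record ('o, 'a) monoidal_category = "('o, 'a) category" +
  tensor_obj :: "'o \<Rightarrow> 'o \<Rightarrow> 'o"  (infixl "\<otimes>\<^sub>o\<index>" 70)
  tensor_arr :: "'a \<Rightarrow> 'a \<Rightarrow> 'a"  (infixl "\<otimes>\<index>" 70)
  unit_obj :: 'o  ("\<one>\<index>")

locale strict_monoidal_category = category C
  for C :: "('o, 'a, 'm) monoidal_category_scheme" (structure) +
  assumes unit_closed: "\<one> \<in> Obj C"
    and tensor_obj_closed: "\<lbrakk>X \<in> Obj C; Y \<in> Obj C\<rbrakk> \<Longrightarrow> X \<otimes>\<^sub>o Y \<in> Obj C"
    and tensor_arr_closed: "\<lbrakk>f \<in> hom C X Y; f' \<in> hom C X' Y'\<rbrakk>
      \<Longrightarrow> f \<otimes> f' \<in> hom C (X \<otimes>\<^sub>o X') (Y \<otimes>\<^sub>o Y')"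
    and tensor_ident: "\<lbrakk>X \<in> Obj C; Y \<in> Obj C\<rbrakk> \<Longrightarrow> \<i>\<d> X \<otimes> \<i>\<d> Y = \<i>\<d> (X \<otimes>\<^sub>o Y)"
    and tensor_comp: "\<lbrakk>f \<in> hom C X Y; g \<in> hom C Y Z; f' \<in> hom C X' Y'; g' \<in> hom C Y' Z'\<rbrakk>
      \<Longrightarrow> (g \<cdot> f) \<otimes> (g' \<cdot> f') = (g \<otimes> g') \<cdot> (f \<otimes> f')"
    and tensor_obj_assoc: "\<lbrakk>X \<in> Obj C; Y \<in> Obj C; Z \<in> Obj C\<rbrakk>
      \<Longrightarrow> (X \<otimes>\<^sub>o Y) \<otimes>\<^sub>o Z = X \<otimes>\<^sub>o (Y \<otimes>\<^sub>o Z)"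
    and tensor_arr_assoc: "\<lbrakk>f \<in> Arr C; g \<in> Arr C; h \<in> Arr C\<rbrakk>
      \<Longrightarrow> (f \<otimes> g) \<otimes> h = f \<otimes> (g \<otimes> h)"
    and unit_obj_left: "X \<in> Obj C \<Longrightarrow> \<one> \<otimes>\<^sub>o X = X"
    and unit_obj_right: "X \<in> Obj C \<Longrightarrow> X \<otimes>\<^sub>o \<one> = X"
    and unit_arr_left: "f \<in> Arr C \<Longrightarrow> \<i>\<d> \<one> \<otimes> f = f"
    and unit_arr_right: "f \<in> Arr C \<Longrightarrow> f \<otimes> \<i>\<d> \<one> = f"

text \<open>
  The chosen right dual of \<open>X\<close> is \<open>rdual C X\<close>, with evaluation \<open>X \<otimes> rdual X \<rightarrow> \<one>\<close> and
  coevaluation \<open>\<one> \<rightarrow> rdual X \<otimes> X\<close>, subject to the two triangle identities.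
\<close>

record ('o, 'a) right_autonomous_category = "('o, 'a) monoidal_category" +
  rdual :: "'o \<Rightarrow> 'o"
  ev :: "'o \<Rightarrow> 'a"
  coev :: "'o \<Rightarrow> 'a"

locale right_autonomous_category = strict_monoidal_category C
  for C :: "('o, 'a, 'm) right_autonomous_category_scheme" (structure) +
  assumes rdual_closed: "X \<in> Obj C \<Longrightarrow> rdual C X \<in> Obj C"
    and ev_closed: "X \<in> Obj C \<Longrightarrow> ev C X \<in> hom C (X \<otimes>\<^sub>o rdual C X) \<one>"
    and coev_closed: "X \<in> Obj C \<Longrightarrow> coev C X \<in> hom C \<one> (rdual C X \<otimes>\<^sub>o X)"
    and triangle_obj: "X \<in> Obj C \<Longrightarrow> (ev C X \<otimes> \<i>\<d> X) \<cdot> (\<i>\<d> X \<otimes> coev C X) = \<i>\<d> X"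
    and triangle_rdual: "X \<in> Obj C \<Longrightarrow>
      (\<i>\<d> (rdual C X) \<otimes> ev C X) \<cdot> (coev C X \<otimes> \<i>\<d> (rdual C X)) = \<i>\<d> (rdual C X)"

text \<open>The dual \<open>rdual Y \<rightarrow> rdual X\<close> of an arrow \<open>f : X \<rightarrow> Y\<close>.\<close>

definition rdual_arr :: "('o, 'a, 'm) right_autonomous_category_scheme \<Rightarrow> 'a \<Rightarrow> 'a" where
  "rdual_arr C f =
     (let X = Dom C f; Y = Cod C f in
        (\<i>\<d>\<^bsub>C\<^esub> (rdual C X) \<otimes>\<^bsub>C\<^esub> ev C Y)
        \<cdot>\<^bsub>C\<^esub> (\<i>\<d>\<^bsub>C\<^esub> (rdual C X) \<otimes>\<^bsub>C\<^esub> f \<otimes>\<^bsub>C\<^esub> \<i>\<d>\<^bsub>C\<^esub> (rdual C Y))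
        \<cdot>\<^bsub>C\<^esub> (coev C X \<otimes>\<^bsub>C\<^esub> \<i>\<d>\<^bsub>C\<^esub> (rdual C Y)))"


section \<open>Monads and bimonads\<close>

text \<open>\<open>FO T\<close> and \<open>FA T\<close> are the actions of the endofunctor \<open>T\<close> on objects and on arrows.\<close>

record ('o, 'a) endofunctor =
  FO :: "'o \<Rightarrow> 'o"
  FA :: "'a \<Rightarrow> 'a"

locale endofunctor = category C
  for C :: "('o, 'a, 'm) category_scheme" (structure) and T :: "('o, 'a, 't) endofunctor_scheme" +
  assumes FO_closed: "X \<in> Obj C \<Longrightarrow> FO T X \<in> Obj C"
    and FA_closed: "f \<in> hom C X Y \<Longrightarrow> FA T f \<in> hom C (FO T X) (FO T Y)"
    and FA_ident: "X \<in> Obj C \<Longrightarrow> FA T (\<i>\<d> X) = \<i>\<d> (FO T X)"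
    and FA_comp: "\<lbrakk>f \<in> hom C X Y; g \<in> hom C Y Z\<rbrakk> \<Longrightarrow> FA T (g \<cdot> f) = FA T g \<cdot> FA T f"

record ('o, 'a) monad = "('o, 'a) endofunctor" +
  \<mu> :: "'o \<Rightarrow> 'a"
  \<eta> :: "'o \<Rightarrow> 'a"

locale monad = endofunctor C T
  for C :: "('o, 'a, 'm) category_scheme" (structure) and T :: "('o, 'a, 't) monad_scheme" +
  assumes mu_closed: "X \<in> Obj C \<Longrightarrow> \<mu> T X \<in> hom C (FO T (FO T X)) (FO T X)"
    and mu_natural: "f \<in> hom C X Y \<Longrightarrow> \<mu> T Y \<cdot> FA T (FA T f) = FA T f \<cdot> \<mu> T X"
    and eta_closed: "X \<in> Obj C \<Longrightarrow> \<eta> T X \<in> hom C X (FO T X)"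
    and eta_natural: "f \<in> hom C X Y \<Longrightarrow> \<eta> T Y \<cdot> f = FA T f \<cdot> \<eta> T X"
    and mu_assoc: "X \<in> Obj C \<Longrightarrow> \<mu> T X \<cdot> FA T (\<mu> T X) = \<mu> T X \<cdot> \<mu> T (FO T X)"
    and mu_eta_left: "X \<in> Obj C \<Longrightarrow> \<mu> T X \<cdot> \<eta> T (FO T X) = \<i>\<d> (FO T X)"
    and mu_eta_right: "X \<in> Obj C \<Longrightarrow> \<mu> T X \<cdot> FA T (\<eta> T X) = \<i>\<d> (FO T X)"

record ('o, 'a) bimonad = "('o, 'a) monad" +
  T2 :: "'o \<Rightarrow> 'o \<Rightarrow> 'a"
  T0 :: 'a

locale bimonad = strict_monoidal_category C + monad C T
  for C :: "('o, 'a, 'm) monoidal_category_scheme" (structure)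
    and T :: "('o, 'a, 't) bimonad_scheme" +
  assumes T2_closed: "\<lbrakk>X \<in> Obj C; Y \<in> Obj C\<rbrakk>
      \<Longrightarrow> T2 T X Y \<in> hom C (FO T (X \<otimes>\<^sub>o Y)) (FO T X \<otimes>\<^sub>o FO T Y)"
    and T2_natural: "\<lbrakk>f \<in> hom C X X'; g \<in> hom C Y Y'\<rbrakk>
      \<Longrightarrow> T2 T X' Y' \<cdot> FA T (f \<otimes> g) = (FA T f \<otimes> FA T g) \<cdot> T2 T X Y"
    and T0_closed: "T0 T \<in> hom C (FO T \<one>) \<one>"
    and T2_coassoc: "\<lbrakk>X \<in> Obj C; Y \<in> Obj C; Z \<in> Obj C\<rbrakk>
      \<Longrightarrow> (\<i>\<d> (FO T X) \<otimes> T2 T Y Z) \<cdot> T2 T X (Y \<otimes>\<^sub>o Z)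
        = (T2 T X Y \<otimes> \<i>\<d> (FO T Z)) \<cdot> T2 T (X \<otimes>\<^sub>o Y) Z"
    and T2_counit_right: "X \<in> Obj C \<Longrightarrow> (\<i>\<d> (FO T X) \<otimes> T0 T) \<cdot> T2 T X \<one> = \<i>\<d> (FO T X)"
    and T2_counit_left: "X \<in> Obj C \<Longrightarrow> (T0 T \<otimes> \<i>\<d> (FO T X)) \<cdot> T2 T \<one> X = \<i>\<d> (FO T X)"
    and T2_mu: "\<lbrakk>X \<in> Obj C; Y \<in> Obj C\<rbrakk>
      \<Longrightarrow> T2 T X Y \<cdot> \<mu> T (X \<otimes>\<^sub>o Y)
        = (\<mu> T X \<otimes> \<mu> T Y) \<cdot> T2 T (FO T X) (FO T Y) \<cdot> FA T (T2 T X Y)"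
    and T0_mu: "T0 T \<cdot> \<mu> T \<one> = T0 T \<cdot> FA T (T0 T)"
    and T2_eta: "\<lbrakk>X \<in> Obj C; Y \<in> Obj C\<rbrakk> \<Longrightarrow> T2 T X Y \<cdot> \<eta> T (X \<otimes>\<^sub>o Y) = \<eta> T X \<otimes> \<eta> T Y"
    and T0_eta: "T0 T \<cdot> \<eta> T \<one> = \<i>\<d> \<one>"


section \<open>Right Hopf monads\<close>

text \<open>
  Naturality of \<open>s\<close> is between the contravariant functors \<open>X \<mapsto> T(rdual (T X))\<close> and
  \<open>X \<mapsto> rdual X\<close>.
\<close>

locale right_antipode = bimonad C T + right_autonomous_category C
  for C :: "('o, 'a, 'm) right_autonomous_category_scheme" (structure)
    and T :: "('o, 'a, 't) bimonad_scheme" +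
  fixes s :: "'o \<Rightarrow> 'a"
  assumes antipode_closed: "X \<in> Obj C \<Longrightarrow> s X \<in> hom C (FO T (rdual C (FO T X))) (rdual C X)"
    and antipode_natural: "f \<in> hom C X Y
      \<Longrightarrow> s X \<cdot> FA T (rdual_arr C (FA T f)) = rdual_arr C f \<cdot> s Y"
    and antipode_ev: "X \<in> Obj C
      \<Longrightarrow> T0 T \<cdot> FA T (ev C X) \<cdot> FA T (\<i>\<d> X \<otimes> rdual_arr C (\<eta> T X))
        = ev C (FO T X)
          \<cdot> (\<i>\<d> (FO T X) \<otimes> (s (FO T X) \<cdot> FA T (rdual_arr C (\<mu> T X))))
          \<cdot> T2 T X (rdual C (FO T X))"
    and antipode_coev: "X \<in> Obj C
      \<Longrightarrow> (\<i>\<d> (rdual C X) \<otimes> \<eta> T X) \<cdot> coev C X \<cdot> T0 T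
        = (s X \<otimes> \<mu> T X) \<cdot> T2 T (rdual C (FO T X)) (FO T X) \<cdot> FA T (coev C (FO T X))"

locale right_hopf_monad = bimonad C T + right_autonomous_category C
  for C :: "('o, 'a, 'm) right_autonomous_category_scheme" (structure)
    and T :: "('o, 'a, 't) bimonad_scheme" +
  assumes admits_right_antipode: "\<exists>s. right_antipode C T s"


section \<open>Modules, comodules and Hopf modules\<close>

context
  fixes C :: "('o, 'a, 'm) category_scheme" (structure) and T :: "('o, 'a, 't) monad_scheme"
begin

fun is_module :: "'o \<times> 'a \<Rightarrow> bool" where
  "is_module (M, r) \<longleftrightarrow>
     M \<in> Obj C \<and> r \<in> hom C (FO T M) M \<and>
     r \<cdot> FA T r = r \<cdot> \<mu> T M \<and> r \<cdot> \<eta> T M = \<i>\<d> M"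

fun is_linear :: "'o \<times> 'a \<Rightarrow> 'o \<times> 'a \<Rightarrow> 'a \<Rightarrow> bool" where
  "is_linear (M, r) (N, s) f \<longleftrightarrow> f \<in> hom C M N \<and> f \<cdot> r = s \<cdot> FA T f"

end

context
  fixes C :: "('o, 'a, 'm) monoidal_category_scheme" (structure)
begin

text \<open>Right comodules over a coalgebra \<open>(A, \<Delta>, \<epsilon>)\<close>.\<close>

fun is_right_comodule :: "'o \<times> 'a \<times> 'a \<Rightarrow> 'o \<times> 'a \<Rightarrow> bool" where
  "is_right_comodule (A, \<Delta>, \<epsilon>) (M, \<rho>) \<longleftrightarrow>
     M \<in> Obj C \<and> \<rho> \<in> hom C M (M \<otimes>\<^sub>o A) \<and>
     (\<rho> \<otimes> \<i>\<d> A) \<cdot> \<rho> = (\<i>\<d> M \<otimes> \<Delta>) \<cdot> \<rho> \<and>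
     (\<i>\<d> M \<otimes> \<epsilon>) \<cdot> \<rho> = \<i>\<d> M"

fun is_right_comodule_morphism :: "'o \<times> 'a \<times> 'a \<Rightarrow> 'o \<times> 'a \<Rightarrow> 'o \<times> 'a \<Rightarrow> 'a \<Rightarrow> bool" where
  "is_right_comodule_morphism (A, \<Delta>, \<epsilon>) (M, \<rho>) (N, \<sigma>) f \<longleftrightarrow>
     f \<in> hom C M N \<and> \<sigma> \<cdot> f = (f \<otimes> \<i>\<d> A) \<cdot> \<rho>"

end

context
  fixes C :: "('o, 'a, 'm) monoidal_category_scheme" (structure)
    and T :: "('o, 'a, 't) bimonad_scheme"
begin

text \<open>The coproduct \<open>T2 T \<one> \<one>\<close> starts at \<open>T(\<one> \<otimes> \<one>)\<close>, which is \<open>T(\<one>)\<close> by strictness.\<close>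

definition unit_coalgebra :: "'o \<times> 'a \<times> 'a" where
  "unit_coalgebra = (FO T \<one>, T2 T \<one> \<one>, T0 T)"

fun is_right_hopf_module :: "'o \<times> 'a \<times> 'a \<Rightarrow> bool" where
  "is_right_hopf_module (M, r, \<rho>) \<longleftrightarrow>
     is_module C T (M, r) \<and> is_right_comodule C unit_coalgebra (M, \<rho>) \<and>
     \<rho> \<cdot> r = (r \<otimes> \<mu> T \<one>) \<cdot> T2 T M (FO T \<one>) \<cdot> FA T \<rho>"

fun is_right_hopf_morphism :: "'o \<times> 'a \<times> 'a \<Rightarrow> 'o \<times> 'a \<times> 'a \<Rightarrow> 'a \<Rightarrow> bool" where
  "is_right_hopf_morphism (M, r, \<rho>) (N, s, \<sigma>) f \<longleftrightarrow>
     is_right_hopf_module (M, r, \<rho>) \<and> is_right_hopf_module (N, s, \<sigma>) \<and>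
     is_linear C T (M, r) (N, s) f \<and>
     is_right_comodule_morphism C unit_coalgebra (M, \<rho>) (N, \<sigma>) f"

definition is_right_hopf_isomorphism :: "'o \<times> 'a \<times> 'a \<Rightarrow> 'o \<times> 'a \<times> 'a \<Rightarrow> 'a \<Rightarrow> bool" where
  "is_right_hopf_isomorphism P Q f \<longleftrightarrow>
     is_right_hopf_morphism P Q f \<and>
     (\<exists>g. is_right_hopf_morphism Q P g \<and> g \<cdot> f = \<i>\<d> (fst P) \<and> f \<cdot> g = \<i>\<d> (fst Q))"

definition free_hopf_module :: "'o \<Rightarrow> 'o \<times> 'a \<times> 'a" where
  "free_hopf_module X = (FO T X, \<mu> T X, T2 T X \<one>)"

text \<open>
  \<open>i : E \<rightarrow> M\<close> is a coinvariant part of the comodule \<open>(M, \<rho>)\<close>. By strictness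
  \<open>\<i>\<d> M \<otimes> \<eta> T \<one>\<close> is an arrow \<open>M \<rightarrow> M \<otimes> T(\<one>)\<close>.
\<close>

fun is_coinvariant_part :: "'o \<times> 'a \<Rightarrow> 'o \<Rightarrow> 'a \<Rightarrow> bool" where
  "is_coinvariant_part (M, \<rho>) E i \<longleftrightarrow>
     i \<in> hom C E M \<and> is_equalizer C i \<rho> (\<i>\<d> M \<otimes> \<eta> T \<one>)"

fun preserves_coinvariant_part :: "'o \<times> 'a \<Rightarrow> 'a \<Rightarrow> bool" where
  "preserves_coinvariant_part (M, \<rho>) i \<longleftrightarrow>
     is_equalizer C (FA T i) (FA T \<rho>) (FA T (\<i>\<d> M \<otimes> \<eta> T \<one>))"

end

end

theory Submission
  imports Defs
begin

text \<open>
  For every \<open>T\<close>-module \<open>(M, r)\<close> the fusion operator \<open>H = (r \<otimes> id) T2(M, \<one>) : T(M) \<rightarrow> M \<otimes> T(\<one>)\<close>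
  is invertible: the antipode gives an action on the dual of \<open>M\<close> for which evaluation and
  coevaluation are \<open>T\<close>-linear, and these yield the inverse \<open>K\<close>. For a Hopf module put
  \<open>\<psi> = K \<rho> : M \<rightarrow> T(M)\<close>. Both \<open>T(\<rho>) \<psi>\<close> and \<open>T(id \<otimes> \<eta>) \<psi>\<close> equal \<open>K' (id \<otimes> T2(\<one>, \<one>)) \<rho>\<close>,
  where \<open>K'\<close> belongs to the module \<open>M \<otimes> T(\<one>)\<close>, so \<open>\<psi> = T(i) g\<close> for a unique \<open>g\<close>. Since
  \<open>\<rho> r T(i) = H T(i)\<close> and \<open>r K = id \<otimes> T0\<close>, this \<open>g\<close> is inverse to \<open>r T(i)\<close>.
\<close>

section \<open>Categories and equalizers\<close>

lemma homD:
  assumes "f \<in> hom C X Y"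
  shows "f \<in> Arr C" "Dom C f = X" "Cod C f = Y"
  using assms by (auto simp: hom_def)

lemma homI: "f \<in> Arr C \<Longrightarrow> Dom C f = X \<Longrightarrow> Cod C f = Y \<Longrightarrow> f \<in> hom C X Y"
  by (simp add: hom_def)

lemma hom_self: "f \<in> Arr C \<Longrightarrow> f \<in> hom C (Dom C f) (Cod C f)"
  by (simp add: hom_def)

lemma equalizer_eq: "is_equalizer C i f g \<Longrightarrow> f \<cdot>\<^bsub>C\<^esub> i = g \<cdot>\<^bsub>C\<^esub> i"
  unfolding is_equalizer_def by blast

text \<open>Domain and codomain of \<open>i\<close> are unique, so the objects quantified inside
  \<open>is_equalizer\<close> must be \<open>E\<close> and \<open>A\<close>.\<close>

lemma equalizer_universal:
  assumes "is_equalizer C i f g" "i \<in> hom C E A" "h \<in> hom C Z A"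
    and "f \<cdot>\<^bsub>C\<^esub> h = g \<cdot>\<^bsub>C\<^esub> h"
  shows "\<exists>!k. k \<in> hom C Z E \<and> i \<cdot>\<^bsub>C\<^esub> k = h"
proof -
  obtain E' A' where "i \<in> hom C E' A'"
    and univ: "\<And>Z h. h \<in> hom C Z A' \<and> f \<cdot>\<^bsub>C\<^esub> h = g \<cdot>\<^bsub>C\<^esub> h
      \<longrightarrow> (\<exists>!k. k \<in> hom C Z E' \<and> i \<cdot>\<^bsub>C\<^esub> k = h)"
    using assms(1) unfolding is_equalizer_def by blast
  with assms(2) have "E' = E" "A' = A" by (auto simp: hom_def)
  with univ[of h Z] assms(3,4) show ?thesis by blast
qed

context category
begin

text \<open>Typing by equations for \<open>Dom\<close> and \<open>Cod\<close> instead of hom-sets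
  leaves no middle object to instantiate, so simp can discharge the side conditions by
  itself.\<close>

lemma comp_simps [simp]:
  assumes "f \<in> Arr C" "g \<in> Arr C" "Dom C g = Cod C f"
  shows "g \<cdot> f \<in> Arr C" "Dom C (g \<cdot> f) = Dom C f" "Cod C (g \<cdot> f) = Cod C g"
  using comp_closed[OF hom_self[OF assms(1)], of g "Cod C g"] assms by (auto simp: hom_def)

lemma ident_simps [simp]:
  assumes "X \<in> Obj C"
  shows "\<i>\<d> X \<in> Arr C" "Dom C (\<i>\<d> X) = X" "Cod C (\<i>\<d> X) = X"
  using ident_closed[OF assms] by (auto simp: hom_def)

lemma obj_simps [simp]: "f \<in> Arr C \<Longrightarrow> Dom C f \<in> Obj C" "f \<in> Arr C \<Longrightarrow> Cod C f \<in> Obj C"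
  by (simp_all add: dom_closed cod_closed)

lemma hom_obj: "f \<in> hom C X Y \<Longrightarrow> X \<in> Obj C" "f \<in> hom C X Y \<Longrightarrow> Y \<in> Obj C"
  by (auto simp: hom_def)

lemma unit_simps [simp]:
  "f \<in> Arr C \<Longrightarrow> Dom C f = X \<Longrightarrow> f \<cdot> \<i>\<d> X = f"
  "f \<in> Arr C \<Longrightarrow> Cod C f = X \<Longrightarrow> \<i>\<d> X \<cdot> f = f"
  using comp_ident_right comp_ident_left by (auto simp: hom_def)

lemma assoc [simp]:
  assumes "f \<in> Arr C" "g \<in> Arr C" "h \<in> Arr C" "Dom C g = Cod C f" "Dom C h = Cod C g"
  shows "(h \<cdot> g) \<cdot> f = h \<cdot> (g \<cdot> f)"
  using comp_assoc[of f "Dom C f" "Cod C f" g "Cod C g" h "Cod C h"] assms by (auto simp: hom_def)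

text \<open>Simp nests composites to the right; this applies an equation between composites to the
  two leading factors of a longer one.\<close>

lemma rewrite_left:
  assumes "h \<cdot> g = k" "f \<in> Arr C" "g \<in> Arr C" "h \<in> Arr C" "Dom C g = Cod C f" "Dom C h = Cod C g"
  shows "h \<cdot> (g \<cdot> f) = k \<cdot> f"
  using assms by (metis assoc)

text \<open>Equalizers are monic: \<open>h\<close> and \<open>h'\<close> both factor the same arrow
  \<open>i \<cdot> h\<close>, and such a factorization is unique.\<close>

lemma equalizer_cancel:
  assumes eq: "is_equalizer C i f g" and i: "i \<in> hom C E A"
    and f: "f \<in> hom C A B" and g: "g \<in> hom C A B"
    and h: "h \<in> hom C Z E" "h' \<in> hom C Z E" and "i \<cdot> h = i \<cdot> h'"
  shows "h = h'"
proof -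
  have "f \<cdot> (i \<cdot> h) = g \<cdot> (i \<cdot> h)"
    using comp_assoc[OF h(1) i f] comp_assoc[OF h(1) i g] equalizer_eq[OF eq] by simp
  from equalizer_universal[OF eq i comp_closed[OF h(1) i] this] h \<open>i \<cdot> h = i \<cdot> h'\<close>
  show ?thesis by auto
qed

end

context strict_monoidal_category
begin

lemma tensor_simps [simp]:
  assumes "f \<in> Arr C" "g \<in> Arr C"
  shows "f \<otimes> g \<in> Arr C" "Dom C (f \<otimes> g) = Dom C f \<otimes>\<^sub>o Dom C g"
    "Cod C (f \<otimes> g) = Cod C f \<otimes>\<^sub>o Cod C g"
  using tensor_arr_closed[OF hom_self[OF assms(1)] hom_self[OF assms(2)]] by (auto simp: hom_def)

lemmas monoidal_simps [simp] =
  unit_closed tensor_obj_closed tensor_ident tensor_obj_assoc unit_obj_left unit_obj_right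
  unit_arr_left unit_arr_right tensor_arr_assoc

lemma interchange:
  assumes "f \<in> Arr C" "g \<in> Arr C" "f' \<in> Arr C" "g' \<in> Arr C" "Dom C g = Cod C f" "Dom C g' = Cod C f'"
  shows "(g \<otimes> g') \<cdot> (f \<otimes> f') = (g \<cdot> f) \<otimes> (g' \<cdot> f')"
  using tensor_comp[of f "Dom C f" "Cod C f" g "Cod C g" f' "Dom C f'" "Cod C f'" g' "Cod C g'"]
    assms by (auto simp: hom_def)

text \<open>Right-nested composites need the interchange law also for two leading factors followed
  by a tail.\<close>

lemma interchange_left:
  assumes "f \<in> Arr C" "g \<in> Arr C" "f' \<in> Arr C" "g' \<in> Arr C" "Dom C g = Cod C f" "Dom C g' = Cod C f'"
    and "h \<in> Arr C" "Cod C h = Dom C f \<otimes>\<^sub>o Dom C f'"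
  shows "(g \<otimes> g') \<cdot> (f \<otimes> f') \<cdot> h = ((g \<cdot> f) \<otimes> (g' \<cdot> f')) \<cdot> h"
  by (rule rewrite_left) (use assms in \<open>auto simp: interchange\<close>)

lemmas merge = interchange interchange_left

text \<open>Arrows on different tensor factors can be performed in either order; this licenses the
  moves usually drawn in string diagrams.\<close>

lemma slide:
  assumes "f \<in> Arr C" "g \<in> Arr C" "Dom C f = X" "Cod C f = X'" "Dom C g = Y" "Cod C g = Y'"
  shows "(f \<otimes> \<i>\<d> Y') \<cdot> (\<i>\<d> X \<otimes> g) = f \<otimes> g" "(\<i>\<d> X' \<otimes> g) \<cdot> (f \<otimes> \<i>\<d> Y) = f \<otimes> g"
  using assms by (auto simp: interchange)

end

section \<open>Duality\<close>

context right_autonomous_category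
begin

lemma duality_simps [simp]:
  assumes "X \<in> Obj C"
  shows "rdual C X \<in> Obj C"
    "ev C X \<in> Arr C" "Dom C (ev C X) = X \<otimes>\<^sub>o rdual C X" "Cod C (ev C X) = \<one>"
    "coev C X \<in> Arr C" "Dom C (coev C X) = \<one>" "Cod C (coev C X) = rdual C X \<otimes>\<^sub>o X"
  using rdual_closed[OF assms] ev_closed[OF assms] coev_closed[OF assms] by (auto simp: hom_def)

lemma rdual_arr_simps [simp]:
  assumes "f \<in> Arr C"
  shows "rdual_arr C f \<in> Arr C" "Dom C (rdual_arr C f) = rdual C (Cod C f)"
    "Cod C (rdual_arr C f) = rdual C (Dom C f)"
  using assms unfolding rdual_arr_def Let_def by simp_all

text \<open>Expanding the dual of \<open>f\<close> creates a zigzag on \<open>X\<close>. Once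
  \<open>ev C X\<close> is slid past \<open>?u\<close>, the triangle identity of \<open>X\<close>
  straightens it.\<close>

lemma ev_natural:
  assumes "f \<in> Arr C" "Dom C f = X" "Cod C f = Y"
  shows "ev C X \<cdot> (\<i>\<d> X \<otimes> rdual_arr C f) = ev C Y \<cdot> (f \<otimes> \<i>\<d> (rdual C Y))"
proof -
  have [simp]: "X \<in> Obj C" "Y \<in> Obj C" "f \<in> Arr C" "Dom C f = X" "Cod C f = Y" using assms by auto
  let ?X = "rdual C X" and ?Y = "rdual C Y"
  let ?u = "ev C Y \<cdot> (f \<otimes> \<i>\<d> ?Y)"
  have 1: "rdual_arr C f = (\<i>\<d> ?X \<otimes> ?u) \<cdot> (coev C X \<otimes> \<i>\<d> ?Y)"
    unfolding rdual_arr_def Let_def by (simp add: merge)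
  have "ev C X \<cdot> (\<i>\<d> X \<otimes> rdual_arr C f)
      = ev C X \<cdot> (\<i>\<d> X \<otimes> (\<i>\<d> ?X \<otimes> ?u)) \<cdot> (\<i>\<d> X \<otimes> (coev C X \<otimes> \<i>\<d> ?Y))"
    unfolding 1 by (simp add: interchange)
  \<comment> \<open>Reading \<open>tensor_ident\<close> backwards splits the identity on a tensor
    product, so that associativity makes both sides agree.\<close>
  also have "\<dots> = (ev C X \<cdot> (\<i>\<d> (X \<otimes>\<^sub>o ?X) \<otimes> ?u)) \<cdot> (\<i>\<d> X \<otimes> (coev C X \<otimes> \<i>\<d> ?Y))"
    by (simp flip: tensor_ident)
  also have "ev C X \<cdot> (\<i>\<d> (X \<otimes>\<^sub>o ?X) \<otimes> ?u) = ev C X \<otimes> ?u"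
    using slide(1)[of "ev C X" ?u "X \<otimes>\<^sub>o ?X" \<one> "X \<otimes>\<^sub>o ?Y" \<one>] by simp
  also have "\<dots> = ?u \<cdot> (ev C X \<otimes> \<i>\<d> (X \<otimes>\<^sub>o ?Y))"
    using slide(2)[of "ev C X" ?u "X \<otimes>\<^sub>o ?X" \<one> "X \<otimes>\<^sub>o ?Y" \<one>] by simp
  also have "(?u \<cdot> (ev C X \<otimes> \<i>\<d> (X \<otimes>\<^sub>o ?Y))) \<cdot> (\<i>\<d> X \<otimes> (coev C X \<otimes> \<i>\<d> ?Y))
      = ?u \<cdot> ((ev C X \<otimes> \<i>\<d> X) \<otimes> \<i>\<d> ?Y) \<cdot> ((\<i>\<d> X \<otimes> coev C X) \<otimes> \<i>\<d> ?Y)"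
    by simp
  also have "((ev C X \<otimes> \<i>\<d> X) \<otimes> \<i>\<d> ?Y) \<cdot> ((\<i>\<d> X \<otimes> coev C X) \<otimes> \<i>\<d> ?Y)
      = ((ev C X \<otimes> \<i>\<d> X) \<cdot> (\<i>\<d> X \<otimes> coev C X)) \<otimes> (\<i>\<d> ?Y \<cdot> \<i>\<d> ?Y)"
    by (rule interchange) simp_all
  also have "\<dots> = \<i>\<d> (X \<otimes>\<^sub>o ?Y)" by (simp add: triangle_obj)
  finally show ?thesis by simp
qed

text \<open>Mirror image of \<open>ev_natural\<close>: sliding \<open>coev C Y\<close> past
  \<open>?u\<close> leaves a zigzag, this time on \<open>Y\<close>.\<close>

lemma coev_natural:
  assumes "f \<in> Arr C" "Dom C f = X" "Cod C f = Y"
  shows "(rdual_arr C f \<otimes> \<i>\<d> Y) \<cdot> coev C Y = (\<i>\<d> (rdual C X) \<otimes> f) \<cdot> coev C X"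
proof -
  have [simp]: "X \<in> Obj C" "Y \<in> Obj C" "f \<in> Arr C" "Dom C f = X" "Cod C f = Y" using assms by auto
  let ?X = "rdual C X" and ?Y = "rdual C Y"
  let ?u = "(\<i>\<d> ?X \<otimes> f) \<cdot> coev C X"
  have 1: "rdual_arr C f = (\<i>\<d> ?X \<otimes> ev C Y) \<cdot> (?u \<otimes> \<i>\<d> ?Y)"
  proof -
    have "((\<i>\<d> ?X \<otimes> f) \<otimes> \<i>\<d> ?Y) \<cdot> (coev C X \<otimes> \<i>\<d> ?Y) = ?u \<otimes> (\<i>\<d> ?Y \<cdot> \<i>\<d> ?Y)"
      by (rule interchange) simp_all
    then show ?thesis unfolding rdual_arr_def Let_def by simp
  qed
  have "rdual_arr C f \<otimes> \<i>\<d> Y = (\<i>\<d> ?X \<otimes> ev C Y \<otimes> \<i>\<d> Y) \<cdot> (?u \<otimes> \<i>\<d> ?Y \<otimes> \<i>\<d> Y)"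
    using interchange[of "?u \<otimes> \<i>\<d> ?Y" "\<i>\<d> ?X \<otimes> ev C Y" "\<i>\<d> Y" "\<i>\<d> Y"] unfolding 1 by simp
  then have "(rdual_arr C f \<otimes> \<i>\<d> Y) \<cdot> coev C Y
      = (\<i>\<d> ?X \<otimes> ev C Y \<otimes> \<i>\<d> Y) \<cdot> (?u \<otimes> \<i>\<d> (?Y \<otimes>\<^sub>o Y)) \<cdot> coev C Y"
    by simp
  also have "(?u \<otimes> \<i>\<d> (?Y \<otimes>\<^sub>o Y)) \<cdot> coev C Y = ?u \<otimes> coev C Y"
    using slide(1)[of ?u "coev C Y" \<one> "?X \<otimes>\<^sub>o Y" \<one> "?Y \<otimes>\<^sub>o Y"] by simp
  also have "\<dots> = (\<i>\<d> (?X \<otimes>\<^sub>o Y) \<otimes> coev C Y) \<cdot> ?u"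
    using slide(2)[of ?u "coev C Y" \<one> "?X \<otimes>\<^sub>o Y" \<one> "?Y \<otimes>\<^sub>o Y"] by simp
  also have "(\<i>\<d> ?X \<otimes> ev C Y \<otimes> \<i>\<d> Y) \<cdot> (\<i>\<d> (?X \<otimes>\<^sub>o Y) \<otimes> coev C Y) \<cdot> ?u
      = ((\<i>\<d> ?X \<otimes> (ev C Y \<otimes> \<i>\<d> Y)) \<cdot> (\<i>\<d> ?X \<otimes> (\<i>\<d> Y \<otimes> coev C Y))) \<cdot> ?u"
    by (simp flip: tensor_ident)
  also have "(\<i>\<d> ?X \<otimes> (ev C Y \<otimes> \<i>\<d> Y)) \<cdot> (\<i>\<d> ?X \<otimes> (\<i>\<d> Y \<otimes> coev C Y))
      = (\<i>\<d> ?X \<cdot> \<i>\<d> ?X) \<otimes> ((ev C Y \<otimes> \<i>\<d> Y) \<cdot> (\<i>\<d> Y \<otimes> coev C Y))"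
    by (rule interchange) simp_all
  also have "\<dots> = \<i>\<d> (?X \<otimes>\<^sub>o Y)" by (simp add: triangle_obj)
  finally show ?thesis by simp
qed

text \<open>An arrow into the dual is recovered from its pairing with \<open>X\<close> by bending
  back with \<open>coev C X\<close>; the triangle identity of the dual makes this a left inverse of
  pairing.\<close>

lemma ev_cancel:
  assumes [simp]: "X \<in> Obj C"
    and h: "h \<in> Arr C" "Dom C h = Z" "Cod C h = rdual C X"
    and h': "h' \<in> Arr C" "Dom C h' = Z" "Cod C h' = rdual C X"
    and eq: "ev C X \<cdot> (\<i>\<d> X \<otimes> h) = ev C X \<cdot> (\<i>\<d> X \<otimes> h')"
  shows "h = h'"
proof -
  let ?X = "rdual C X"
  have transpose: "(\<i>\<d> ?X \<otimes> (ev C X \<cdot> (\<i>\<d> X \<otimes> k))) \<cdot> (coev C X \<otimes> \<i>\<d> Z) = k"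
    if [simp]: "k \<in> Arr C" "Dom C k = Z" "Cod C k = ?X" for k
  proof -
    have [simp]: "Z \<in> Obj C" using obj_simps(1)[OF that(1)] by simp
    have "(\<i>\<d> ?X \<otimes> (ev C X \<cdot> (\<i>\<d> X \<otimes> k))) \<cdot> (coev C X \<otimes> \<i>\<d> Z)
        = (\<i>\<d> ?X \<otimes> ev C X) \<cdot> (\<i>\<d> (?X \<otimes>\<^sub>o X) \<otimes> k) \<cdot> (coev C X \<otimes> \<i>\<d> Z)"
      by (simp add: merge flip: tensor_ident)
    also have "(\<i>\<d> (?X \<otimes>\<^sub>o X) \<otimes> k) \<cdot> (coev C X \<otimes> \<i>\<d> Z) = (coev C X \<otimes> \<i>\<d> ?X) \<cdot> k"
      using slide[of "coev C X" k \<one> "?X \<otimes>\<^sub>o X" Z ?X] by simp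
    also have "(\<i>\<d> ?X \<otimes> ev C X) \<cdot> (coev C X \<otimes> \<i>\<d> ?X) \<cdot> k = k"
      using rewrite_left[OF triangle_rdual, of X k] by simp
    finally show ?thesis .
  qed
  show ?thesis using transpose[OF h] transpose[OF h'] unfolding eq by (rule trans[OF sym])
qed

lemma rdual_arr_ident:
  assumes [simp]: "X \<in> Obj C"
  shows "rdual_arr C (\<i>\<d> X) = \<i>\<d> (rdual C X)"
  by (rule ev_cancel[of X _ "rdual C X"]) (simp_all add: ev_natural[of _ X X])

text \<open>Both sides have the same pairing under \<open>ev\<close>, by \<open>ev_natural\<close>
  for \<open>f\<close>, for \<open>g\<close> and for their composite.\<close>

lemma rdual_arr_comp:
  assumes [simp]: "f \<in> Arr C" "g \<in> Arr C" "Dom C g = Cod C f"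
  shows "rdual_arr C (g \<cdot> f) = rdual_arr C f \<cdot> rdual_arr C g"
proof (rule ev_cancel[of "Dom C f" _ "rdual C (Cod C g)"])
  let ?X = "Dom C f" and ?Y = "Cod C f" and ?Z = "Cod C g"
  have "ev C ?X \<cdot> (\<i>\<d> ?X \<otimes> (rdual_arr C f \<cdot> rdual_arr C g))
      = (ev C ?X \<cdot> (\<i>\<d> ?X \<otimes> rdual_arr C f)) \<cdot> (\<i>\<d> ?X \<otimes> rdual_arr C g)"
    by (simp add: merge)
  also have "\<dots> = (ev C ?Y \<cdot> (\<i>\<d> ?Y \<otimes> rdual_arr C g)) \<cdot> (f \<otimes> \<i>\<d> (rdual C ?Z))"
    by (simp add: ev_natural[of f ?X ?Y] merge)
  also have "\<dots> = ev C ?Z \<cdot> ((g \<cdot> f) \<otimes> \<i>\<d> (rdual C ?Z))"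
    by (simp add: ev_natural[of g ?Y ?Z] merge)
  finally show "ev C ?X \<cdot> (\<i>\<d> ?X \<otimes> rdual_arr C (g \<cdot> f))
      = ev C ?X \<cdot> (\<i>\<d> ?X \<otimes> (rdual_arr C f \<cdot> rdual_arr C g))"
    by (simp add: ev_natural[of "g \<cdot> f" ?X ?Z])
qed simp_all

end

section \<open>Bimonads and Hopf modules\<close>

context endofunctor
begin

lemma FO_simp [simp]: "X \<in> Obj C \<Longrightarrow> FO T X \<in> Obj C"
  by (rule FO_closed)

lemma FA_simps [simp]:
  assumes "f \<in> Arr C"
  shows "FA T f \<in> Arr C" "Dom C (FA T f) = FO T (Dom C f)" "Cod C (FA T f) = FO T (Cod C f)"
  using FA_closed[OF hom_self[OF assms]] by (auto simp: hom_def)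

lemmas [simp] = FA_ident

lemma FA_comp': "\<lbrakk>f \<in> Arr C; g \<in> Arr C; Dom C g = Cod C f\<rbrakk> \<Longrightarrow> FA T (g \<cdot> f) = FA T g \<cdot> FA T f"
  by (rule FA_comp[of f "Dom C f" "Cod C f" g "Cod C g"]) (simp_all add: hom_def)

end

context monad
begin

lemma monad_simps [simp]:
  assumes "X \<in> Obj C"
  shows "\<mu> T X \<in> Arr C" "Dom C (\<mu> T X) = FO T (FO T X)" "Cod C (\<mu> T X) = FO T X"
    "\<eta> T X \<in> Arr C" "Dom C (\<eta> T X) = X" "Cod C (\<eta> T X) = FO T X"
  using mu_closed[OF assms] eta_closed[OF assms] by (auto simp: hom_def)

end

context bimonad
begin

lemma bimonad_simps [simp]:
  "X \<in> Obj C \<Longrightarrow> Y \<in> Obj C \<Longrightarrow> T2 T X Y \<in> Arr C"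
  "X \<in> Obj C \<Longrightarrow> Y \<in> Obj C \<Longrightarrow> Dom C (T2 T X Y) = FO T (X \<otimes>\<^sub>o Y)"
  "X \<in> Obj C \<Longrightarrow> Y \<in> Obj C \<Longrightarrow> Cod C (T2 T X Y) = FO T X \<otimes>\<^sub>o FO T Y"
  "T0 T \<in> Arr C" "Dom C (T0 T) = FO T \<one>" "Cod C (T0 T) = \<one>"
  using T2_closed[of X Y] T0_closed by (auto simp: hom_def)

lemma T2_natural':
  assumes "f \<in> Arr C" "g \<in> Arr C" "Dom C f = X" "Cod C f = X'" "Dom C g = Y" "Cod C g = Y'"
  shows "T2 T X' Y' \<cdot> FA T (f \<otimes> g) = (FA T f \<otimes> FA T g) \<cdot> T2 T X Y"
  using assms by (intro T2_natural homI)

lemma module_homD: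
  assumes "is_module C T (M, r)"
  shows "M \<in> Obj C" "r \<in> Arr C" "Dom C r = FO T M" "Cod C r = M"
    "r \<cdot> FA T r = r \<cdot> \<mu> T M" "r \<cdot> \<eta> T M = \<i>\<d> M"
  using assms by (auto simp: hom_def)

text \<open>Associativity of the tensor action comes from \<open>T2_mu\<close>, its unit law from
  \<open>T2_eta\<close>. With the free module on \<open>\<one>\<close> as second factor, this makes
  \<open>M \<otimes>\<^sub>o FO T \<one>\<close> a module.\<close>

lemma tensor_module:
  assumes M: "is_module C T (M, r)" and N: "is_module C T (N, s)"
  shows "is_module C T (M \<otimes>\<^sub>o N, (r \<otimes> s) \<cdot> T2 T M N)"
proof -
  note [simp] = module_homD(1-4)[OF M] module_homD(1-4)[OF N]
  let ?R = "(r \<otimes> s) \<cdot> T2 T M N"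
  have "?R \<cdot> FA T ?R = (r \<otimes> s) \<cdot> (T2 T M N \<cdot> FA T (r \<otimes> s)) \<cdot> FA T (T2 T M N)"
    by (simp add: FA_comp')
  also have "\<dots> = ((r \<cdot> \<mu> T M) \<otimes> (s \<cdot> \<mu> T N)) \<cdot> T2 T (FO T M) (FO T N) \<cdot> FA T (T2 T M N)"
    by (simp add: T2_natural'[of r s "FO T M" M "FO T N" N] merge module_homD(5)[OF M] module_homD(5)[OF N])
  also have "\<dots> = ?R \<cdot> \<mu> T (M \<otimes>\<^sub>o N)"
    by (simp add: T2_mu merge)
  finally have "?R \<cdot> FA T ?R = ?R \<cdot> \<mu> T (M \<otimes>\<^sub>o N)" .
  moreover have "?R \<cdot> \<eta> T (M \<otimes>\<^sub>o N) = \<i>\<d> (M \<otimes>\<^sub>o N)"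
    by (simp add: T2_eta interchange module_homD(6)[OF M] module_homD(6)[OF N])
  ultimately show ?thesis by (simp add: homI)
qed

lemma free_module: "X \<in> Obj C \<Longrightarrow> is_module C T (FO T X, \<mu> T X)"
  by (simp add: homI mu_assoc mu_eta_left)

text \<open>The comodule laws are coassociativity and right counit of \<open>T2\<close> at the unit
  object; compatibility of action and coaction is \<open>T2_mu\<close>.\<close>

lemma free_hopf_module_is_hopf_module:
  assumes [simp]: "X \<in> Obj C"
  shows "is_right_hopf_module C T (free_hopf_module C T X)"
  using free_module[of X] T2_coassoc[of X \<one> \<one>] T2_counit_right[of X] T2_mu[of X \<one>]
  by (simp add: free_hopf_module_def unit_coalgebra_def homI)

text \<open>Conjugating by the two inverse laws carries linearity and colinearity over to
  \<open>g\<close>, so only an inverse in the underlying category has to be constructed.\<close>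

lemma invertible_hopf_morphism:
  assumes f: "is_right_hopf_morphism C T (M, r, \<rho>) (N, s, \<sigma>) f"
    and g: "g \<in> hom C N M" and gf: "g \<cdot> f = \<i>\<d> M" and fg: "f \<cdot> g = \<i>\<d> N"
  shows "is_right_hopf_isomorphism C T (M, r, \<rho>) (N, s, \<sigma>) f"
proof -
  have fD: "f \<in> hom C M N" "f \<cdot> r = s \<cdot> FA T f" "\<sigma> \<cdot> f = (f \<otimes> \<i>\<d> (FO T \<one>)) \<cdot> \<rho>"
    and MN: "is_right_hopf_module C T (M, r, \<rho>)" "is_right_hopf_module C T (N, s, \<sigma>)"
    using f by (auto simp: unit_coalgebra_def)
  have [simp]: "M \<in> Obj C" "N \<in> Obj C" using MN by auto
  have [simp]: "r \<in> Arr C" "Dom C r = FO T M" "Cod C r = M"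
    "s \<in> Arr C" "Dom C s = FO T N" "Cod C s = N"
    "\<rho> \<in> Arr C" "Dom C \<rho> = M" "Cod C \<rho> = M \<otimes>\<^sub>o FO T \<one>"
    "\<sigma> \<in> Arr C" "Dom C \<sigma> = N" "Cod C \<sigma> = N \<otimes>\<^sub>o FO T \<one>"
    using MN by (auto simp: unit_coalgebra_def hom_def)
  note [simp] = homD[OF fD(1)] homD[OF g]
  have "g \<cdot> s = (g \<cdot> s) \<cdot> FA T (f \<cdot> g)" by (simp add: fg)
  also have "\<dots> = g \<cdot> (s \<cdot> FA T f) \<cdot> FA T g" by (simp add: FA_comp')
  also have "\<dots> = (g \<cdot> f) \<cdot> r \<cdot> FA T g" unfolding fD(2)[symmetric] by simp
  also have "\<dots> = r \<cdot> FA T g" by (simp only: gf) simp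
  finally have linear: "g \<cdot> s = r \<cdot> FA T g" .
  have "(g \<otimes> \<i>\<d> (FO T \<one>)) \<cdot> \<sigma> = (g \<otimes> \<i>\<d> (FO T \<one>)) \<cdot> \<sigma> \<cdot> (f \<cdot> g)" by (simp add: fg)
  also have "\<dots> = (g \<otimes> \<i>\<d> (FO T \<one>)) \<cdot> (\<sigma> \<cdot> f) \<cdot> g" by simp
  also have "\<dots> = ((g \<cdot> f) \<otimes> \<i>\<d> (FO T \<one>)) \<cdot> \<rho> \<cdot> g" unfolding fD(3) by (simp add: merge)
  also have "\<dots> = \<rho> \<cdot> g" by (simp add: gf)
  finally have "(g \<otimes> \<i>\<d> (FO T \<one>)) \<cdot> \<sigma> = \<rho> \<cdot> g" .
  with linear g MN have "is_right_hopf_morphism C T (N, s, \<sigma>) (M, r, \<rho>) g"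
    by (simp add: unit_coalgebra_def)
  with f gf fg show ?thesis unfolding is_right_hopf_isomorphism_def by auto
qed

end

section \<open>Fusion operators\<close>

context bimonad
begin

text \<open>The module is recovered as the codomain of its action. By strictness the source
  \<open>T(M \<otimes> \<one>)\<close> is \<open>T(M)\<close>.\<close>

definition fusion :: "'a \<Rightarrow> 'a" where
  "fusion r = (r \<otimes> \<i>\<d> (FO T \<one>)) \<cdot> T2 T (Cod C r) \<one>"

lemma fusion_simps [simp]:
  assumes "is_module C T (M, r)"
  shows "fusion r \<in> Arr C" "Dom C (fusion r) = FO T M" "Cod C (fusion r) = M \<otimes>\<^sub>o FO T \<one>"
  using module_homD[OF assms] by (simp_all add: fusion_def)

lemma counit_fusion:
  assumes "is_module C T (M, r)"
  shows "(\<i>\<d> M \<otimes> T0 T) \<cdot> fusion r = r"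
proof -
  note [simp] = module_homD(1-4)[OF assms]
  have "(\<i>\<d> M \<otimes> T0 T) \<cdot> fusion r = (r \<otimes> T0 T) \<cdot> T2 T M \<one>"
    by (simp add: fusion_def merge)
  also have "\<dots> = r \<cdot> (\<i>\<d> (FO T M) \<otimes> T0 T) \<cdot> T2 T M \<one>"
    using slide(2)[of r "T0 T" "FO T M" M "FO T \<one>" \<one>]
      interchange_left[of "\<i>\<d> (FO T M)" r "T0 T" "\<i>\<d> \<one>" "T2 T M \<one>"] by simp
  also have "\<dots> = r" by (simp add: T2_counit_right)
  finally show ?thesis .
qed

text \<open>Naturality of \<open>T2\<close> in its first argument, with linearity of
  \<open>f\<close> to exchange the actions. It will be applied to the coaction of a Hopf
  module.\<close>

lemma fusion_natural:
  assumes M: "is_module C T (M, r)" and N: "is_module C T (N, s)"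
    and f: "is_linear C T (M, r) (N, s) f"
  shows "fusion s \<cdot> FA T f = (f \<otimes> \<i>\<d> (FO T \<one>)) \<cdot> fusion r"
proof -
  have linear: "f \<cdot> r = s \<cdot> FA T f" and fhom: "f \<in> hom C M N" using f by auto
  note [simp] = module_homD(1-4)[OF M] module_homD(1-4)[OF N] homD[OF fhom]
  have "T2 T N \<one> \<cdot> FA T f = (FA T f \<otimes> \<i>\<d> (FO T \<one>)) \<cdot> T2 T M \<one>"
    using T2_natural'[of f "\<i>\<d> \<one>" M N \<one> \<one>] by simp
  then show ?thesis by (simp add: fusion_def merge linear)
qed

text \<open>Naturality of \<open>T2\<close> brings \<open>\<eta>\<close> next to
  \<open>\<mu>\<close>, where they cancel. For coinvariants the coaction may be replaced by
  \<open>\<i>\<d> M \<otimes> \<eta> T \<one>\<close>, which is how the left side arises.\<close>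

lemma fusion_coinvariant:
  assumes M: "is_module C T (M, r)"
  shows "((r \<otimes> \<mu> T \<one>) \<cdot> T2 T M (FO T \<one>)) \<cdot> FA T (\<i>\<d> M \<otimes> \<eta> T \<one>) = fusion r"
proof -
  note [simp] = module_homD(1-4)[OF M]
  show ?thesis
    by (simp add: fusion_def T2_natural'[of "\<i>\<d> M" "\<eta> T \<one>" M M \<one> "FO T \<one>"] merge mu_eta_right)
qed

text \<open>The arrow \<open>\<i>\<d> M \<otimes> \<eta> T \<one>\<close> need not be linear, so
  this square replaces \<open>fusion_natural\<close> for it. It reduces to coassociativity of
  \<open>T2\<close>, after \<open>fusion_coinvariant\<close> on the first factor.\<close>

lemma fusion_tensor_coinvariant:
  assumes M: "is_module C T (M, r)"
  shows "fusion ((r \<otimes> \<mu> T \<one>) \<cdot> T2 T M (FO T \<one>)) \<cdot> FA T (\<i>\<d> M \<otimes> \<eta> T \<one>)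
    = (\<i>\<d> M \<otimes> T2 T \<one> \<one>) \<cdot> fusion r"
proof -
  note [simp] = module_homD(1-4)[OF M]
  let ?j = "\<i>\<d> M \<otimes> \<eta> T \<one>" and ?A = "FO T \<one>"
  let ?R = "(r \<otimes> \<mu> T \<one>) \<cdot> T2 T M ?A"
  \<comment> \<open>By strictness \<open>?j\<close> is also
    \<open>?j \<otimes> \<i>\<d> \<one>\<close>, the form to which naturality of \<open>T2\<close>
    applies.\<close>
  have "fusion ?R \<cdot> FA T ?j = (?R \<otimes> \<i>\<d> ?A) \<cdot> (T2 T (M \<otimes>\<^sub>o ?A) \<one> \<cdot> FA T (?j \<otimes> \<i>\<d> \<one>))"
    by (simp add: fusion_def)
  also have "\<dots> = ((?R \<cdot> FA T ?j) \<otimes> \<i>\<d> ?A) \<cdot> T2 T M \<one>"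
    using T2_natural'[of ?j "\<i>\<d> \<one>" M "M \<otimes>\<^sub>o ?A" \<one> \<one>]
      interchange_left[of "FA T ?j" ?R "\<i>\<d> ?A" "\<i>\<d> ?A" "T2 T M \<one>"] by simp
  also have "\<dots> = (fusion r \<otimes> \<i>\<d> ?A) \<cdot> T2 T M \<one>"
    unfolding fusion_coinvariant[OF M] ..
  also have "\<dots> = (r \<otimes> \<i>\<d> ?A \<otimes> \<i>\<d> ?A) \<cdot> (T2 T M \<one> \<otimes> \<i>\<d> ?A) \<cdot> T2 T M \<one>"
    using interchange_left[of "T2 T M \<one>" "r \<otimes> \<i>\<d> ?A" "\<i>\<d> ?A" "\<i>\<d> ?A" "T2 T M \<one>"]
    by (simp add: fusion_def del: tensor_ident)
  also have "\<dots> = (r \<otimes> \<i>\<d> (?A \<otimes>\<^sub>o ?A)) \<cdot> (\<i>\<d> (FO T M) \<otimes> T2 T \<one> \<one>) \<cdot> T2 T M \<one>"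
    using T2_coassoc[of M \<one> \<one>] by simp
  also have "\<dots> = (\<i>\<d> M \<otimes> T2 T \<one> \<one>) \<cdot> fusion r"
    by (simp add: fusion_def merge)
  finally show ?thesis .
qed

end

section \<open>Dual modules and the inverse of the fusion operator\<close>

context right_antipode
begin

lemma antipode_simps [simp]:
  assumes "X \<in> Obj C"
  shows "s X \<in> Arr C" "Dom C (s X) = FO T (rdual C (FO T X))" "Cod C (s X) = rdual C X"
  using antipode_closed[OF assms] by (auto simp: hom_def)

text \<open>
  The antipode axioms amount to the \<open>T\<close>-linearity of evaluation and coevaluation for this action
  on the dual of \<open>(M, r)\<close>.
\<close>

definition dual_action :: "'a \<Rightarrow> 'a" where
  "dual_action r = s (Cod C r) \<cdot> FA T (rdual_arr C r)"

lemma dual_action_simps [simp]: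
  assumes "is_module C T (M, r)"
  shows "dual_action r \<in> Arr C" "Dom C (dual_action r) = FO T (rdual C M)"
    "Cod C (dual_action r) = rdual C M"
  using module_homD[OF assms] by (simp_all add: dual_action_def)

text \<open>Precompose the first antipode axiom at \<open>M\<close> with
  \<open>T(\<i>\<d> M \<otimes> rdual_arr C r)\<close>. The unit law of \<open>r\<close> removes the
  dual of \<open>\<eta>\<close>, and associativity of \<open>r\<close> together with naturality of
  \<open>s\<close> turns the dual of \<open>\<mu>\<close> into the dual action.\<close>

lemma ev_linear:
  assumes M: "is_module C T (M, r)"
  shows "(ev C M \<cdot> (r \<otimes> dual_action r)) \<cdot> T2 T M (rdual C M) = T0 T \<cdot> FA T (ev C M)"
proof -
  note [simp] = module_homD(1-4)[OF M] dual_action_simps[OF M]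
  let ?W = "rdual C M" and ?N = "FO T M"
  have eta: "rdual_arr C (\<eta> T M) \<cdot> rdual_arr C r = \<i>\<d> ?W"
    using rdual_arr_comp[of "\<eta> T M" r] module_homD(6)[OF M] rdual_arr_ident[of M] by simp
  have "rdual_arr C (\<mu> T M) \<cdot> rdual_arr C r = rdual_arr C (FA T r) \<cdot> rdual_arr C r"
    using rdual_arr_comp[of "\<mu> T M" r] rdual_arr_comp[of "FA T r" r] module_homD(5)[OF M] by simp
  then have "FA T (rdual_arr C (\<mu> T M)) \<cdot> FA T (rdual_arr C r)
      = FA T (rdual_arr C (FA T r)) \<cdot> FA T (rdual_arr C r)"
    by (simp flip: FA_comp')
  \<comment> \<open>Naturality of \<open>s\<close> is taken along the action itself, as an arrow
    \<open>r : T(M) \<rightarrow> M\<close>.\<close>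
  then have mu: "(s ?N \<cdot> FA T (rdual_arr C (\<mu> T M))) \<cdot> FA T (rdual_arr C r)
      = rdual_arr C r \<cdot> dual_action r"
    using rewrite_left[OF antipode_natural[of r ?N M], of "FA T (rdual_arr C r)"]
    by (simp add: dual_action_def homI)
  have "T0 T \<cdot> FA T (ev C M)
      = (T0 T \<cdot> FA T (ev C M) \<cdot> FA T (\<i>\<d> M \<otimes> rdual_arr C (\<eta> T M))) \<cdot> FA T (\<i>\<d> M \<otimes> rdual_arr C r)"
    by (simp add: interchange eta flip: FA_comp')
  also have "\<dots> = ev C ?N \<cdot> (\<i>\<d> ?N \<otimes> (s ?N \<cdot> FA T (rdual_arr C (\<mu> T M))))
      \<cdot> (T2 T M (rdual C ?N) \<cdot> FA T (\<i>\<d> M \<otimes> rdual_arr C r))"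
    unfolding antipode_ev[OF module_homD(1)[OF M]] by simp
  also have "\<dots> = ev C ?N \<cdot> (\<i>\<d> ?N \<otimes> ((s ?N \<cdot> FA T (rdual_arr C (\<mu> T M))) \<cdot> FA T (rdual_arr C r)))
      \<cdot> T2 T M ?W"
    by (simp add: T2_natural'[of "\<i>\<d> M" "rdual_arr C r" M M ?W "rdual C ?N"] merge)
  also have "\<dots> = (ev C ?N \<cdot> (\<i>\<d> ?N \<otimes> rdual_arr C r)) \<cdot> (\<i>\<d> ?N \<otimes> dual_action r) \<cdot> T2 T M ?W"
    unfolding mu by (simp add: merge)
  also have "\<dots> = (ev C M \<cdot> (r \<otimes> dual_action r)) \<cdot> T2 T M ?W"
    by (simp add: ev_natural[of r ?N M] merge)
  finally show ?thesis ..
qed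

text \<open>Postcompose the second antipode axiom with \<open>\<i>\<d> \<otimes> r\<close>. The unit
  law clears the left-hand side; on the other, \<open>r \<cdot> \<mu>\<close> becomes
  \<open>r \<cdot> T(r)\<close>, and \<open>coev_natural\<close> moves the inner \<open>r\<close> to
  the dual factor, where it joins \<open>s M\<close> to form the dual action.\<close>

lemma coev_linear:
  assumes M: "is_module C T (M, r)"
  shows "(dual_action r \<otimes> r) \<cdot> T2 T (rdual C M) M \<cdot> FA T (coev C M) = coev C M \<cdot> T0 T"
proof -
  note [simp] = module_homD(1-4)[OF M] dual_action_simps[OF M]
  let ?W = "rdual C M" and ?N = "FO T M"
  have "coev C M \<cdot> T0 T = (\<i>\<d> ?W \<otimes> r) \<cdot> ((\<i>\<d> ?W \<otimes> \<eta> T M) \<cdot> coev C M \<cdot> T0 T)"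
    by (simp add: merge module_homD(6)[OF M])
  also have "\<dots> = (s M \<otimes> (r \<cdot> \<mu> T M)) \<cdot> T2 T (rdual C ?N) ?N \<cdot> FA T (coev C ?N)"
    unfolding antipode_coev[OF module_homD(1)[OF M]] by (simp add: merge)
  also have "\<dots> = (s M \<otimes> r) \<cdot> ((\<i>\<d> (FO T (rdual C ?N)) \<otimes> FA T r) \<cdot> T2 T (rdual C ?N) ?N) \<cdot> FA T (coev C ?N)"
    by (simp add: merge flip: module_homD(5)[OF M])
  also have "\<dots> = (s M \<otimes> r) \<cdot> T2 T (rdual C ?N) M \<cdot> FA T ((\<i>\<d> (rdual C ?N) \<otimes> r) \<cdot> coev C ?N)"
    using rewrite_left[OF T2_natural'[of "\<i>\<d> (rdual C ?N)" r "rdual C ?N" "rdual C ?N" ?N M],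
        of "FA T (coev C ?N)"]
    by (simp add: FA_comp')
  also have "\<dots> = (s M \<otimes> r) \<cdot> (T2 T (rdual C ?N) M \<cdot> FA T (rdual_arr C r \<otimes> \<i>\<d> M)) \<cdot> FA T (coev C M)"
    by (simp add: FA_comp' flip: coev_natural[of r ?N M])
  also have "\<dots> = (dual_action r \<otimes> r) \<cdot> T2 T ?W M \<cdot> FA T (coev C M)"
    by (simp add: T2_natural'[of "rdual_arr C r" "\<i>\<d> M" ?W "rdual C ?N" M M] merge dual_action_def)
  finally show ?thesis ..
qed

text \<open>\<open>T(coev)\<close> is split by \<open>T2\<close>; its dual leg passes through the
  dual action and is then paired with the given factor \<open>M\<close>, leaving the leg
  \<open>T(M)\<close>.\<close>

definition fusion_inv :: "'a \<Rightarrow> 'a" where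
  "fusion_inv r = (let M = Cod C r in
     (ev C M \<otimes> \<i>\<d> (FO T M))
     \<cdot> (\<i>\<d> M \<otimes> ((dual_action r \<otimes> \<i>\<d> (FO T M)) \<cdot> T2 T (rdual C M) M \<cdot> FA T (coev C M))))"

lemma fusion_inv_simps [simp]:
  assumes "is_module C T (M, r)"
  shows "fusion_inv r \<in> Arr C" "Dom C (fusion_inv r) = M \<otimes>\<^sub>o FO T \<one>" "Cod C (fusion_inv r) = FO T M"
  using module_homD[OF assms] dual_action_simps[OF assms] by (simp_all add: fusion_inv_def Let_def)

text \<open>Coassociativity brings \<open>r\<close> and the dual action together on \<open>M\<close>
  and its dual, where \<open>ev_linear\<close> applies. The resulting \<open>T0\<close> is absorbed
  by the left counit, and the rest is \<open>T\<close> of a triangle identity.\<close>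

lemma fusion_inv_left:
  assumes M: "is_module C T (M, r)"
  shows "fusion_inv r \<cdot> fusion r = \<i>\<d> (FO T M)"
proof -
  note [simp] = module_homD(1-4)[OF M] dual_action_simps[OF M]
  let ?W = "rdual C M" and ?N = "FO T M" and ?a = "dual_action r"
  have "fusion_inv r \<cdot> fusion r
      = (ev C M \<otimes> \<i>\<d> ?N) \<cdot> (r \<otimes> ((?a \<otimes> \<i>\<d> ?N) \<cdot> T2 T ?W M \<cdot> FA T (coev C M))) \<cdot> T2 T M \<one>"
    by (simp add: fusion_inv_def fusion_def Let_def merge)
  also have "\<dots> = (ev C M \<otimes> \<i>\<d> ?N) \<cdot> (r \<otimes> (?a \<otimes> \<i>\<d> ?N)) \<cdot> (\<i>\<d> ?N \<otimes> T2 T ?W M)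
      \<cdot> ((\<i>\<d> ?N \<otimes> FA T (coev C M)) \<cdot> T2 T M \<one>)"
    by (simp add: merge)
  also have "\<dots> = (ev C M \<otimes> \<i>\<d> ?N) \<cdot> (r \<otimes> (?a \<otimes> \<i>\<d> ?N)) \<cdot> ((\<i>\<d> ?N \<otimes> T2 T ?W M)
      \<cdot> T2 T M (?W \<otimes>\<^sub>o M)) \<cdot> FA T (\<i>\<d> M \<otimes> coev C M)"
    using T2_natural'[of "\<i>\<d> M" "coev C M" M M \<one> "?W \<otimes>\<^sub>o M"] by simp
  also have "\<dots> = (ev C M \<otimes> \<i>\<d> ?N) \<cdot> ((r \<otimes> ?a) \<otimes> \<i>\<d> ?N) \<cdot> (T2 T M ?W \<otimes> \<i>\<d> ?N)
      \<cdot> T2 T (M \<otimes>\<^sub>o ?W) M \<cdot> FA T (\<i>\<d> M \<otimes> coev C M)"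
    by (simp add: T2_coassoc)
  \<comment> \<open>Associativity is switched off to keep \<open>r \<otimes> ?a\<close> as one block
    for the interchange law.\<close>
  also have "\<dots> = (((ev C M \<cdot> (r \<otimes> ?a)) \<cdot> T2 T M ?W) \<otimes> \<i>\<d> ?N)
      \<cdot> T2 T (M \<otimes>\<^sub>o ?W) M \<cdot> FA T (\<i>\<d> M \<otimes> coev C M)"
    by (simp add: merge del: tensor_arr_assoc)
  also have "\<dots> = (T0 T \<otimes> \<i>\<d> ?N) \<cdot> ((FA T (ev C M) \<otimes> \<i>\<d> ?N)
      \<cdot> T2 T (M \<otimes>\<^sub>o ?W) M) \<cdot> FA T (\<i>\<d> M \<otimes> coev C M)"
    unfolding ev_linear[OF M] by (simp add: merge)
  also have "\<dots> = ((T0 T \<otimes> \<i>\<d> ?N) \<cdot> T2 T \<one> M) \<cdot> FA T ((ev C M \<otimes> \<i>\<d> M) \<cdot> (\<i>\<d> M \<otimes> coev C M))"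
    using rewrite_left[OF T2_natural'[of "ev C M" "\<i>\<d> M" "M \<otimes>\<^sub>o ?W" \<one> M M],
        of "FA T (\<i>\<d> M \<otimes> coev C M)"]
    by (simp add: FA_comp')
  also have "\<dots> = \<i>\<d> ?N"
    by (simp only: T2_counit_left triangle_obj module_homD(1)[OF M]) simp
  finally show ?thesis .
qed

lemma fusion_inv_right:
  assumes M: "is_module C T (M, r)"
  shows "fusion r \<cdot> fusion_inv r = \<i>\<d> (M \<otimes>\<^sub>o FO T \<one>)"
proof -
  note [simp] = module_homD(1-4)[OF M] dual_action_simps[OF M]
  let ?W = "rdual C M" and ?N = "FO T M" and ?a = "dual_action r" and ?A = "FO T \<one>"
  let ?x = "(?a \<otimes> \<i>\<d> ?N) \<cdot> T2 T ?W M \<cdot> FA T (coev C M)"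
  \<comment> \<open>Coassociativity and \<open>coev_linear\<close> collapse the bent part of the
    inverse to a plain coevaluation; outside this block only a zigzag on \<open>M\<close>
    remains.\<close>
  have x: "(\<i>\<d> ?W \<otimes> fusion r) \<cdot> ?x = coev C M \<otimes> \<i>\<d> ?A"
  proof -
    have "(\<i>\<d> ?W \<otimes> fusion r) \<cdot> ?x
        = (?a \<otimes> (r \<otimes> \<i>\<d> ?A)) \<cdot> ((\<i>\<d> (FO T ?W) \<otimes> T2 T M \<one>) \<cdot> T2 T ?W M) \<cdot> FA T (coev C M)"
      by (simp add: fusion_def merge)
    also have "\<dots> = ((?a \<otimes> r) \<otimes> \<i>\<d> ?A) \<cdot> (T2 T ?W M \<otimes> \<i>\<d> ?A)
        \<cdot> (T2 T (?W \<otimes>\<^sub>o M) \<one> \<cdot> FA T (coev C M))"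
      using T2_coassoc[of ?W M \<one>] by simp
    also have "\<dots> = (((?a \<otimes> r) \<cdot> T2 T ?W M \<cdot> FA T (coev C M)) \<otimes> \<i>\<d> ?A) \<cdot> T2 T \<one> \<one>"
      using T2_natural'[of "coev C M" "\<i>\<d> \<one>" \<one> "?W \<otimes>\<^sub>o M" \<one> \<one>]
      by (simp add: merge del: tensor_arr_assoc)
    also have "\<dots> = (coev C M \<otimes> \<i>\<d> ?A) \<cdot> (T0 T \<otimes> \<i>\<d> ?A) \<cdot> T2 T \<one> \<one>"
      unfolding coev_linear[OF M] by (simp add: merge)
    also have "\<dots> = coev C M \<otimes> \<i>\<d> ?A" by (simp add: T2_counit_left)
    finally show ?thesis .
  qed
  note [simp] = fusion_simps[OF M]
  have "fusion r \<cdot> fusion_inv r = (fusion r \<cdot> (ev C M \<otimes> \<i>\<d> ?N)) \<cdot> (\<i>\<d> M \<otimes> ?x)"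
    by (simp add: fusion_inv_def Let_def)
  also have "fusion r \<cdot> (ev C M \<otimes> \<i>\<d> ?N) = ev C M \<otimes> fusion r"
    using slide(2)[of "ev C M" "fusion r" "M \<otimes>\<^sub>o ?W" \<one> ?N "M \<otimes>\<^sub>o ?A"] by simp
  also have "\<dots> = (ev C M \<otimes> \<i>\<d> (M \<otimes>\<^sub>o ?A)) \<cdot> (\<i>\<d> M \<otimes> (\<i>\<d> ?W \<otimes> fusion r))"
    using slide(1)[of "ev C M" "fusion r" "M \<otimes>\<^sub>o ?W" \<one> ?N "M \<otimes>\<^sub>o ?A"]
    by (simp flip: tensor_ident)
  also have "((ev C M \<otimes> \<i>\<d> (M \<otimes>\<^sub>o ?A)) \<cdot> (\<i>\<d> M \<otimes> (\<i>\<d> ?W \<otimes> fusion r))) \<cdot> (\<i>\<d> M \<otimes> ?x)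
      = (ev C M \<otimes> \<i>\<d> (M \<otimes>\<^sub>o ?A)) \<cdot> (\<i>\<d> M \<otimes> ((\<i>\<d> ?W \<otimes> fusion r) \<cdot> ?x))"
    by (simp add: merge)
  also have "\<dots> = ((ev C M \<otimes> \<i>\<d> M) \<otimes> \<i>\<d> ?A) \<cdot> ((\<i>\<d> M \<otimes> coev C M) \<otimes> \<i>\<d> ?A)"
    unfolding x by simp
  also have "\<dots> = ((ev C M \<otimes> \<i>\<d> M) \<cdot> (\<i>\<d> M \<otimes> coev C M)) \<otimes> (\<i>\<d> ?A \<cdot> \<i>\<d> ?A)"
    by (rule interchange) simp_all
  also have "\<dots> = \<i>\<d> (M \<otimes>\<^sub>o ?A)" by (simp add: triangle_obj)
  finally show ?thesis .
qed

text \<open>Composing the square with the inverse on either side reverses its fusion arrows. The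
  arrow \<open>v\<close> is left general because the coaction and
  \<open>\<i>\<d> M \<otimes> \<eta> T \<one>\<close> call for different ones.\<close>

lemma fusion_inv_transfer:
  assumes M: "is_module C T (M, r)" and N: "is_module C T (N, t)"
    and u: "u \<in> hom C M N" and v: "v \<in> hom C (M \<otimes>\<^sub>o FO T \<one>) (N \<otimes>\<^sub>o FO T \<one>)"
    and eq: "fusion t \<cdot> FA T u = v \<cdot> fusion r"
  shows "FA T u \<cdot> fusion_inv r = fusion_inv t \<cdot> v"
proof -
  note [simp] = module_homD(1-4)[OF M] module_homD(1-4)[OF N] homD[OF u] homD[OF v]
    fusion_simps[OF M] fusion_simps[OF N] fusion_inv_simps[OF M] fusion_inv_simps[OF N]
  have "FA T u \<cdot> fusion_inv r = (fusion_inv t \<cdot> fusion t) \<cdot> FA T u \<cdot> fusion_inv r"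
    by (simp only: fusion_inv_left[OF N]) simp
  also have "\<dots> = fusion_inv t \<cdot> (fusion t \<cdot> FA T u) \<cdot> fusion_inv r" by simp
  also have "\<dots> = fusion_inv t \<cdot> v \<cdot> (fusion r \<cdot> fusion_inv r)" unfolding eq by simp
  also have "\<dots> = fusion_inv t \<cdot> v" by (simp add: fusion_inv_right[OF M])
  finally show ?thesis .
qed

section \<open>The decomposition of Hopf modules\<close>

lemma hopf_module_decomposition:
  assumes H: "is_right_hopf_module C T (M, r, \<rho>)"
    and E: "is_coinvariant_part C T (M, \<rho>) E i"
    and P: "preserves_coinvariant_part C T (M, \<rho>) i"
  shows "is_right_hopf_isomorphism C T (free_hopf_module C T E) (M, r, \<rho>) (r \<cdot> FA T i)"
proof -
  let ?A = "FO T \<one>" and ?j = "\<i>\<d> M \<otimes> \<eta> T \<one>"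
  let ?R = "(r \<otimes> \<mu> T \<one>) \<cdot> T2 T M ?A"
  let ?f = "r \<cdot> FA T i" and ?\<psi> = "fusion_inv r \<cdot> \<rho>"
  have M: "is_module C T (M, r)" and \<rho>: "\<rho> \<in> hom C M (M \<otimes>\<^sub>o ?A)"
    and coassoc: "(\<rho> \<otimes> \<i>\<d> ?A) \<cdot> \<rho> = (\<i>\<d> M \<otimes> T2 T \<one> \<one>) \<cdot> \<rho>"
    and counit: "(\<i>\<d> M \<otimes> T0 T) \<cdot> \<rho> = \<i>\<d> M"
    and compat: "\<rho> \<cdot> r = (r \<otimes> \<mu> T \<one>) \<cdot> T2 T M ?A \<cdot> FA T \<rho>"
    using H by (auto simp: unit_coalgebra_def)
  have i: "i \<in> hom C E M" and coinv: "\<rho> \<cdot> i = ?j \<cdot> i"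
    using E by (auto dest: equalizer_eq)
  have eq: "is_equalizer C (FA T i) (FA T \<rho>) (FA T ?j)" using P by simp
  have N: "is_module C T (M \<otimes>\<^sub>o ?A, ?R)"
    by (rule tensor_module[OF M free_module]) simp
  note [simp] = module_homD(1-4)[OF M] homD[OF \<rho>] homD[OF i] hom_obj(1)[OF i]
    fusion_simps[OF M] fusion_simps[OF N] fusion_inv_simps[OF M] fusion_inv_simps[OF N]
  \<comment> \<open>The compatibility law of a Hopf module is exactly linearity of the coaction into
    the tensor module.\<close>
  have "is_linear C T (M, r) (M \<otimes>\<^sub>o ?A, ?R) \<rho>"
    using \<rho> compat by simp
  from fusion_inv_transfer[OF M N \<rho> _ fusion_natural[OF M N this]]
  have 1: "FA T \<rho> \<cdot> fusion_inv r = fusion_inv ?R \<cdot> (\<rho> \<otimes> \<i>\<d> ?A)"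
    by (simp add: homI)
  have 2: "FA T ?j \<cdot> fusion_inv r = fusion_inv ?R \<cdot> (\<i>\<d> M \<otimes> T2 T \<one> \<one>)"
    by (rule fusion_inv_transfer[OF M N _ _ fusion_tensor_coinvariant[OF M]]) (simp_all add: homI)
  \<comment> \<open>The two transferred squares differ only in what follows \<open>\<rho>\<close>,
    and coassociativity of the coaction identifies these parts.\<close>
  have "FA T \<rho> \<cdot> ?\<psi> = FA T ?j \<cdot> ?\<psi>"
  proof -
    have "FA T \<rho> \<cdot> ?\<psi> = fusion_inv ?R \<cdot> ((\<rho> \<otimes> \<i>\<d> ?A) \<cdot> \<rho>)"
      using rewrite_left[OF 1, of \<rho>] by simp
    also have "\<dots> = FA T ?j \<cdot> ?\<psi>"
      unfolding coassoc using rewrite_left[OF 2, of \<rho>] by simp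
    finally show ?thesis .
  qed
  then obtain g where g: "g \<in> hom C M (FO T E)" and ig: "FA T i \<cdot> g = ?\<psi>"
    using equalizer_universal[OF eq FA_closed[OF i], of ?\<psi> M] by (auto simp: homI)
  note [simp] = homD[OF g]
  have fg: "?f \<cdot> g = \<i>\<d> M"
  proof -
    have "r \<cdot> fusion_inv r = (\<i>\<d> M \<otimes> T0 T) \<cdot> (fusion r \<cdot> fusion_inv r)"
      using rewrite_left[OF counit_fusion[OF M], of "fusion_inv r"] by simp
    then have "r \<cdot> fusion_inv r = \<i>\<d> M \<otimes> T0 T" by (simp add: fusion_inv_right[OF M])
    \<comment> \<open>Here the counit law of the coaction enters.\<close>
    then have "r \<cdot> ?\<psi> = \<i>\<d> M" using rewrite_left[of r "fusion_inv r" _ \<rho>] counit by simp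
    then show ?thesis by (simp add: ig)
  qed
  have \<rho>f: "\<rho> \<cdot> ?f = fusion r \<cdot> FA T i"
  proof -
    have "\<rho> \<cdot> ?f = ?R \<cdot> FA T (\<rho> \<cdot> i)"
      using rewrite_left[OF compat, of "FA T i"] by (simp add: FA_comp')
    also have "\<dots> = (?R \<cdot> FA T ?j) \<cdot> FA T i" unfolding coinv by (simp add: FA_comp')
    finally show ?thesis unfolding fusion_coinvariant[OF M] .
  qed
  have gf: "g \<cdot> ?f = \<i>\<d> (FO T E)"
  \<comment> \<open>As an equalizer, \<open>T(i)\<close> can be cancelled, so the equation is
    checked after composing with it.\<close>
  proof (rule equalizer_cancel[OF eq FA_closed[OF i], where Z = "FO T E" and B = "FO T (M \<otimes>\<^sub>o ?A)"])
    have "FA T i \<cdot> (g \<cdot> ?f) = fusion_inv r \<cdot> (\<rho> \<cdot> ?f)"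
      using rewrite_left[OF ig, of ?f] by simp
    also have "\<dots> = (fusion_inv r \<cdot> fusion r) \<cdot> FA T i" unfolding \<rho>f by simp
    also have "\<dots> = FA T i \<cdot> \<i>\<d> (FO T E)" by (simp only: fusion_inv_left[OF M]) simp
    finally show "FA T i \<cdot> (g \<cdot> ?f) = FA T i \<cdot> \<i>\<d> (FO T E)" .
  qed (simp_all add: homI)
  have "?f \<cdot> \<mu> T E = (r \<cdot> \<mu> T M) \<cdot> FA T (FA T i)"
    by (simp add: mu_natural[OF i])
  also have "\<dots> = r \<cdot> FA T ?f" by (simp add: FA_comp' flip: module_homD(5)[OF M])
  finally have linear: "?f \<cdot> \<mu> T E = r \<cdot> FA T ?f" .
  \<comment> \<open>Naturality of \<open>T2\<close> along \<open>i\<close> moves \<open>T(i)\<close>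
    inside the fusion operator.\<close>
  have colinear: "\<rho> \<cdot> ?f = (?f \<otimes> \<i>\<d> ?A) \<cdot> T2 T E \<one>"
    unfolding \<rho>f using T2_natural'[of i "\<i>\<d> \<one>" E M \<one> \<one>] by (simp add: fusion_def merge)
  have "is_right_hopf_morphism C T (FO T E, \<mu> T E, T2 T E \<one>) (M, r, \<rho>) ?f"
    using H free_hopf_module_is_hopf_module[of E] linear colinear
    by (simp add: free_hopf_module_def unit_coalgebra_def homI)
  from invertible_hopf_morphism[OF this g gf fg] show ?thesis
    by (simp add: free_hopf_module_def)
qed

end

theorem theorem4p5:
  fixes C :: "('o, 'a) right_autonomous_category"
    and T :: "('o, 'a) bimonad"
    and M E :: 'o and r \<rho> i :: 'a
  assumes "right_hopf_monad C T"
    and "is_right_hopf_module C T (M, r, \<rho>)"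
    and "is_coinvariant_part C T (M, \<rho>) E i"
    and "preserves_coinvariant_part C T (M, \<rho>) i"
  shows "is_right_hopf_isomorphism C T (free_hopf_module C T E) (M, r, \<rho>)
           (r \<cdot>\<^bsub>C\<^esub> FA T i)"
proof -
  \<comment> \<open>The conclusion does not mention the antipode, so any one will do.\<close>
  obtain s where "right_antipode C T s"
    using right_hopf_monad.admits_right_antipode[OF assms(1)] by blast
  from right_antipode.hopf_module_decomposition[OF this assms(2-4)] show ?thesis .
qed

end
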